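(* Let $X$ be a finite connected rack with finite enveloping group $\overline{G_X}=As(X)/\langle g_{x_0}^n\rangle$, and let $\bar\rho:\overline{G_X}\to GL(V)$ be a group representation. If $\overline{G_X}$ has trivial center, i.e. $Z(\overline{G_X})=\{1\}$, then the rack representation $\rho:X\to Conj(GL(V))$ defined by $\rho_x:=\bar\rho_{g_x\langle g_{x_0}^n\rangle}$ for $x\in X$ is strong.
   Context: A rack is a set $X$ with a binary operation $\vartriangleright$ such that for every $x\in X$ the map $L_x:X\to X$, $L_x(y)=x\vartriangleright y$, is bijective, and $x\vartriangleright(y\vartriangleright z)=(x\vartriangleright y)\vartriangleright(x\vartriangleright z)$ for all $x,y,z\in X$. A rack homomorphism is a map preserving $\vartriangleright$. For a group $G$, $Conj(G)$ is the rack on the set $G$ with $g\vartriangleright h=ghg^{-1}$. $Inn(X)$ is the group of permutations of $X$ generated by all $L_x$, $x\in X$. The rack $X$ (assumed nonempty) is connected if $Inn(X)$ acts transitively on $X$. The associated group is $As(X)=\langle g_x,\ x\in X\mid g_{x\vartriangleright y}=g_xg_yg_x^{-1},\ x,y\in X\rangle$. For a finite connected rack all permutations $L_x$ have the same order, denoted $n$; moreover in $As(X)$ the element $g_x^n$ is central and $g_x^n=g_y^n$ for all $x,y\in X$. Fixing $x_0\in X$, the finite enveloping group is the quotient $\overline{G_X}=As(X)/\langle g_{x_0}^n\rangle$. A representation of a rack $X$ on a vector space $V$ is a rack homomorphism $\rho:X\to Conj(GL(V))$, $x\mapsto\rho_x$. A stabilizing family of $X$ is a finite family (sequence, repetitions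 allowed) $u_1,\dots,u_k$ of elements of $X$ with $L_{u_k}L_{u_{k-1}}\cdots L_{u_1}=\mathrm{id}$. The representation $\rho$ is strong if $\rho_{u_k}\rho_{u_{k-1}}\cdots\rho_{u_1}=\mathrm{id}$ for every stabilizing family $u_1,\dots,u_k$ of $X$. *)

theory Defs
  imports "HOL-Algebra.Group_Action" "HOL-Algebra.Generated_Groups" "HOL-Algebra.Module" "HOL-Algebra.Multiplicative_Group"
begin

section \<open>Racks\<close>

record 'a rack = "'a partial_object" +
  rack_op :: "'a \<Rightarrow> 'a \<Rightarrow> 'a" (infixr \<open>\<triangleright>\<index>\<close> 70)

locale rack =
  fixes X (structure)
  assumes left_bij: "x \<in> carrier X \<Longrightarrow> bij_betw (\<lambda>y. x \<triangleright> y) (carrier X) (carrier X)"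
    and left_distrib: "\<lbrakk>x \<in> carrier X; y \<in> carrier X; z \<in> carrier X\<rbrakk>
      \<Longrightarrow> x \<triangleright> (y \<triangleright> z) = (x \<triangleright> y) \<triangleright> (x \<triangleright> z)"
begin

lemma op_closed: "\<lbrakk>x \<in> carrier X; y \<in> carrier X\<rbrakk> \<Longrightarrow> x \<triangleright> y \<in> carrier X"
  using left_bij by (auto simp: bij_betw_def)

end

definition rack_hom :: "('a, 'm) rack_scheme \<Rightarrow> ('b, 'n) rack_scheme \<Rightarrow> ('a \<Rightarrow> 'b) set" where
  "rack_hom X Y = {f \<in> carrier X \<rightarrow> carrier Y.
     \<forall>x\<in>carrier X. \<forall>y\<in>carrier X. f (x \<triangleright>\<^bsub>X\<^esub> y) = f x \<triangleright>\<^bsub>Y\<^esub> f y}"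

definition Conj :: "('g, 'm) monoid_scheme \<Rightarrow> 'g rack" where
  "Conj G = \<lparr>carrier = carrier G, rack_op = (\<lambda>g h. g \<otimes>\<^bsub>G\<^esub> h \<otimes>\<^bsub>G\<^esub> inv\<^bsub>G\<^esub> g)\<rparr>"

text \<open>The left translation is restricted to the carrier, as the elements of \<^const>\<open>BijGroup\<close> are
  extensional functions.\<close>

definition left_trans :: "('a, 'm) rack_scheme \<Rightarrow> 'a \<Rightarrow> 'a \<Rightarrow> 'a" where
  "left_trans X x = (\<lambda>y\<in>carrier X. x \<triangleright>\<^bsub>X\<^esub> y)"

definition Inn :: "('a, 'm) rack_scheme \<Rightarrow> ('a \<Rightarrow> 'a) monoid" where
  "Inn X = (BijGroup (carrier X))
     \<lparr>carrier := generate (BijGroup (carrier X)) (left_trans X ` carrier X)\<rparr>"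

locale connected_rack = rack +
  assumes nonempty: "carrier X \<noteq> {}"
    and transitive: "transitive_action (Inn X) (carrier X) (\<lambda>f. f)"


section \<open>Groups given by generators and relations\<close>

text \<open>A letter \<open>(True, s)\<close> stands for the generator \<open>s\<close>, and \<open>(False, s)\<close> for its formal inverse.
  A relation is a pair of words, to be read as an equation.\<close>

type_synonym 's word = "(bool \<times> 's) list"

definition words :: "'s set \<Rightarrow> 's word set" where
  "words S = lists (UNIV \<times> S)"

inductive_set pres_cong :: "'s set \<Rightarrow> ('s word \<times> 's word) set \<Rightarrow> ('s word \<times> 's word) set"
  for S R where
  refl: "w \<in> words S \<Longrightarrow> (w, w) \<in> pres_cong S R"
| sym: "(u, v) \<in> pres_cong S R \<Longrightarrow> (v, u) \<in> pres_cong S R"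
| trans: "\<lbrakk>(u, v) \<in> pres_cong S R; (v, w) \<in> pres_cong S R\<rbrakk> \<Longrightarrow> (u, w) \<in> pres_cong S R"
| append: "\<lbrakk>(u, v) \<in> pres_cong S R; (u', v') \<in> pres_cong S R\<rbrakk>
    \<Longrightarrow> (u @ u', v @ v') \<in> pres_cong S R"
| cancel: "s \<in> S \<Longrightarrow> ([(b, s), (\<not> b, s)], []) \<in> pres_cong S R"
| rel: "(u, v) \<in> R \<Longrightarrow> (u, v) \<in> pres_cong S R"

definition pres_group :: "'s set \<Rightarrow> ('s word \<times> 's word) set \<Rightarrow> 's word set monoid" where
  "pres_group S R =
    \<lparr>carrier = words S // pres_cong S R,
     mult = (\<lambda>A B. \<Union>u\<in>A. \<Union>v\<in>B. pres_cong S R `` {u @ v}),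
     one = pres_cong S R `` {[]}\<rparr>"

definition pres_gen :: "'s set \<Rightarrow> ('s word \<times> 's word) set \<Rightarrow> 's \<Rightarrow> 's word set" where
  "pres_gen S R s = pres_cong S R `` {[(True, s)]}"

lemma pres_cong_subset:
  assumes "R \<subseteq> words S \<times> words S"
  shows "pres_cong S R \<subseteq> words S \<times> words S"
proof -
  have "u \<in> words S \<and> v \<in> words S" if "(u, v) \<in> pres_cong S R" for u v
    using that assms by (induction rule: pres_cong.induct) (auto simp: words_def)
  then show ?thesis by auto
qed

lemma equiv_pres_cong:
  assumes "R \<subseteq> words S \<times> words S"
  shows "equiv (words S) (pres_cong S R)"
proof (rule equivI)
  show "pres_cong S R \<subseteq> words S \<times> words S"
    by (rule pres_cong_subset[OF assms])
  show "refl_on (words S) (pres_cong S R)"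
    by (rule refl_onI) (rule pres_cong.refl)
  show "sym (pres_cong S R)"
    by (rule symI) (rule pres_cong.sym)
  show "trans (pres_cong S R)"
    by (rule transI) (rule pres_cong.trans)
qed

lemma pres_mult_class:
  assumes R: "R \<subseteq> words S \<times> words S" and uv: "u \<in> words S" "v \<in> words S"
  shows "pres_cong S R `` {u} \<otimes>\<^bsub>pres_group S R\<^esub> pres_cong S R `` {v} = pres_cong S R `` {u @ v}"
proof -
  note E = equiv_pres_cong[OF R]
  have *: "pres_cong S R `` {u' @ v'} = pres_cong S R `` {u @ v}"
    if "u' \<in> pres_cong S R `` {u}" "v' \<in> pres_cong S R `` {v}" for u' v'
    using that by (intro equiv_class_eq[OF E]) (auto intro: pres_cong.append pres_cong.sym)
  have cl: "u \<in> pres_cong S R `` {u}" "v \<in> pres_cong S R `` {v}"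
    using uv by (auto intro: pres_cong.refl)
  have "(\<Union>u'\<in>pres_cong S R `` {u}. \<Union>v'\<in>pres_cong S R `` {v}. pres_cong S R `` {u' @ v'})
    = (\<Union>u'\<in>pres_cong S R `` {u}. \<Union>v'\<in>pres_cong S R `` {v}. pres_cong S R `` {u @ v})"
    by (intro SUP_cong HOL.refl *)
  also have "\<dots> = pres_cong S R `` {u @ v}"
    using cl by (metis UN_constant empty_iff)
  finally show ?thesis by (simp add: pres_group_def)
qed

lemma group_pres_group:
  assumes R: "R \<subseteq> words S \<times> words S"
  shows "group (pres_group S R)"
proof (rule groupI)
  let ?G = "pres_group S R" and ?c = "\<lambda>w. pres_cong S R `` {w}"
  have carr: "carrier ?G = ?c ` words S"
    by (auto simp: pres_group_def quotient_def)
  have one: "\<one>\<^bsub>?G\<^esub> = ?c []"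
    by (simp add: pres_group_def)
  have app: "u @ v \<in> words S" if "u \<in> words S" "v \<in> words S" for u v
    using that by (auto simp: words_def)
  note m = pres_mult_class[OF R]
  show "x \<otimes>\<^bsub>?G\<^esub> y \<in> carrier ?G" if "x \<in> carrier ?G" "y \<in> carrier ?G" for x y
    using that by (auto simp: carr m app)
  show "\<one>\<^bsub>?G\<^esub> \<in> carrier ?G"
    by (auto simp: carr one words_def)
  show "x \<otimes>\<^bsub>?G\<^esub> y \<otimes>\<^bsub>?G\<^esub> z = x \<otimes>\<^bsub>?G\<^esub> (y \<otimes>\<^bsub>?G\<^esub> z)"
    if "x \<in> carrier ?G" "y \<in> carrier ?G" "z \<in> carrier ?G" for x y z
    using that by (auto simp: carr m app)
  show "\<one>\<^bsub>?G\<^esub> \<otimes>\<^bsub>?G\<^esub> x = x" if "x \<in> carrier ?G" for x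
  proof -
    have "[] \<in> words S" by (simp add: words_def)
    then show ?thesis using that by (auto simp: carr one m)
  qed
  show "\<exists>y\<in>carrier ?G. y \<otimes>\<^bsub>?G\<^esub> x = \<one>\<^bsub>?G\<^esub>" if x: "x \<in> carrier ?G" for x
  proof -
    obtain w where w: "w \<in> words S" "x = ?c w" using x by (auto simp: carr)
    have "\<exists>w'\<in>words S. (w' @ w, []) \<in> pres_cong S R"
      using w(1)
    proof (induction w)
      case Nil
      then show ?case by (intro bexI[of _ "[]"]) (auto intro: pres_cong.refl)
    next
      case (Cons l w)
      obtain b s where l: "l = (b, s)" by force
      from Cons.prems have s: "s \<in> S" and w: "w \<in> words S" by (auto simp: words_def l)
      from Cons.IH[OF w] obtain w' where w': "w' \<in> words S" "(w' @ w, []) \<in> pres_cong S R" by blast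
      have c: "([(\<not> b, s), (b, s)] @ w, [] @ w) \<in> pres_cong S R"
        using pres_cong.cancel[OF s, of "\<not> b" R]
        by (intro pres_cong.append pres_cong.refl w) simp
      have "(w' @ ([(\<not> b, s), (b, s)] @ w), w' @ ([] @ w)) \<in> pres_cong S R"
        using w'(1) by (intro pres_cong.append pres_cong.refl c)
      then have "((w' @ [(\<not> b, s)]) @ l # w, []) \<in> pres_cong S R"
        using w'(2) by (auto simp: l intro: pres_cong.trans)
      then show ?case
        using w'(1) s by (intro bexI[of _ "w' @ [(\<not> b, s)]"]) (auto simp: words_def)
    qed
    then obtain w' where w': "w' \<in> words S" "(w' @ w, []) \<in> pres_cong S R" by blast
    have "?c w' \<otimes>\<^bsub>?G\<^esub> x = \<one>\<^bsub>?G\<^esub>"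
      using equiv_class_eq[OF equiv_pres_cong[OF R] w'(2)] by (simp add: w m one w'(1))
    then show ?thesis using w'(1) by (auto simp: carr)
  qed
qed


section \<open>The associated group and the finite enveloping group\<close>

definition As_rels :: "('a, 'm) rack_scheme \<Rightarrow> ('a word \<times> 'a word) set" where
  "As_rels X = {([(True, x \<triangleright>\<^bsub>X\<^esub> y)], [(True, x), (True, y), (False, x)]) | x y.
     x \<in> carrier X \<and> y \<in> carrier X}"

definition As :: "('a, 'm) rack_scheme \<Rightarrow> 'a word set monoid" where
  "As X = pres_group (carrier X) (As_rels X)"

definition As_gen :: "('a, 'm) rack_scheme \<Rightarrow> 'a \<Rightarrow> 'a word set" where
  "As_gen X x = pres_gen (carrier X) (As_rels X) x"

lemma (in rack) group_As: "group (As X)"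
  unfolding As_def
  by (rule group_pres_group) (auto simp: As_rels_def words_def op_closed)

text \<open>The number \<open>n\<close> is the order of the permutation \<open>L\<^sub>x\<close>; for a finite connected rack it does
  not depend on \<open>x\<close>, and the subgroup generated by \<open>g\<^sub>x\<^sup>n\<close> is then central, hence normal.\<close>

definition env_subgroup :: "('a, 'm) rack_scheme \<Rightarrow> 'a \<Rightarrow> 'a word set set" where
  "env_subgroup X x\<^sub>0 = generate (As X)
     {As_gen X x\<^sub>0 [^]\<^bsub>As X\<^esub> group.ord (BijGroup (carrier X)) (left_trans X x\<^sub>0)}"

definition fin_env_group :: "('a, 'm) rack_scheme \<Rightarrow> 'a \<Rightarrow> 'a word set set monoid" where
  "fin_env_group X x\<^sub>0 = As X Mod env_subgroup X x\<^sub>0"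

definition fin_env_gen :: "('a, 'm) rack_scheme \<Rightarrow> 'a \<Rightarrow> 'a \<Rightarrow> 'a word set set" where
  "fin_env_gen X x\<^sub>0 x = env_subgroup X x\<^sub>0 #>\<^bsub>As X\<^esub> As_gen X x"

definition group_center :: "('g, 'm) monoid_scheme \<Rightarrow> 'g set" where
  "group_center G = {z \<in> carrier G. \<forall>g\<in>carrier G. z \<otimes>\<^bsub>G\<^esub> g = g \<otimes>\<^bsub>G\<^esub> z}"


section \<open>Strong representations\<close>

definition GL :: "('k, 'm) ring_scheme \<Rightarrow> ('k, 'v, 'n) module_scheme \<Rightarrow> ('v \<Rightarrow> 'v) monoid" where
  "GL K V = (BijGroup (carrier V))
     \<lparr>carrier := {f \<in> Bij (carrier V).
        (\<forall>u\<in>carrier V. \<forall>v\<in>carrier V. f (u \<oplus>\<^bsub>V\<^esub> v) = f u \<oplus>\<^bsub>V\<^esub> f v) \<and>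
        (\<forall>a\<in>carrier K. \<forall>v\<in>carrier V. f (a \<odot>\<^bsub>V\<^esub> v) = a \<odot>\<^bsub>V\<^esub> f v)}\<rparr>"

lemma group_GL:
  assumes "module K V"
  shows "group (GL K V)"
proof -
  interpret module K V by fact
  interpret B: group "BijGroup (carrier V)" by (rule group_BijGroup)
  have "subgroup (carrier (GL K V)) (BijGroup (carrier V))"
  proof (rule B.subgroupI)
    show "carrier (GL K V) \<subseteq> carrier (BijGroup (carrier V))"
      by (auto simp: GL_def BijGroup_def)
    have "(\<lambda>v\<in>carrier V. v) \<in> carrier (GL K V)"
      by (auto simp: GL_def id_Bij)
    then show "carrier (GL K V) \<noteq> {}" by blast
  next
    fix f assume f: "f \<in> carrier (GL K V)"
    then have fB: "f \<in> Bij (carrier V)" by (simp add: GL_def)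
    then have bij: "bij_betw f (carrier V) (carrier V)" by (simp add: Bij_def)
    let ?g = "inv_into (carrier V) f"
    have gc: "?g v \<in> carrier V" if "v \<in> carrier V" for v
      using that Bij_inv_into_mem[OF fB] by blast
    have fg: "f (?g v) = v" if "v \<in> carrier V" for v
      using that bij by (simp add: bij_betw_inv_into_right)
    have gf: "?g v = u" if "u \<in> carrier V" "v = f u" for u v
      using that bij by (simp add: bij_betw_inv_into_left)
    have "?g (u \<oplus>\<^bsub>V\<^esub> v) = ?g u \<oplus>\<^bsub>V\<^esub> ?g v" if "u \<in> carrier V" "v \<in> carrier V" for u v
      using that f by (intro gf) (auto simp: gc fg GL_def)
    moreover have "?g (a \<odot>\<^bsub>V\<^esub> v) = a \<odot>\<^bsub>V\<^esub> ?g v" if "a \<in> carrier K" "v \<in> carrier V" for a v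
      using that f by (intro gf) (auto simp: gc fg GL_def)
    ultimately show "inv\<^bsub>BijGroup (carrier V)\<^esub> f \<in> carrier (GL K V)"
      using restrict_inv_into_Bij[OF fB] by (auto simp: inv_BijGroup[OF fB] GL_def)
  next
    fix f g assume "f \<in> carrier (GL K V)" "g \<in> carrier (GL K V)"
    then show "f \<otimes>\<^bsub>BijGroup (carrier V)\<^esub> g \<in> carrier (GL K V)"
      using Bij_imp_funcset[of g "carrier V"]
      by (auto simp: GL_def BijGroup_def compose_Bij compose_eq Pi_iff)
  qed
  then have "group ((BijGroup (carrier V))\<lparr>carrier := carrier (GL K V)\<rparr>)"
    by (rule B.subgroup_imp_group)
  then show ?thesis by (simp add: GL_def)
qed

definition rack_representation ::
    "('a, 'm) rack_scheme \<Rightarrow> ('k, 'p) ring_scheme \<Rightarrow> ('k, 'v, 'n) module_scheme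
     \<Rightarrow> ('a \<Rightarrow> 'v \<Rightarrow> 'v) \<Rightarrow> bool" where
  "rack_representation X K V \<rho> \<longleftrightarrow> \<rho> \<in> rack_hom X (Conj (GL K V))"

text \<open>For \<open>us = [u\<^sub>1, \<dots>, u\<^sub>k]\<close> this is the product \<open>\<phi> u\<^sub>k \<otimes> \<dots> \<otimes> \<phi> u\<^sub>1\<close>.\<close>

definition rev_prod :: "('g, 'm) monoid_scheme \<Rightarrow> ('a \<Rightarrow> 'g) \<Rightarrow> 'a list \<Rightarrow> 'g" where
  "rev_prod G \<phi> us = foldr (\<otimes>\<^bsub>G\<^esub>) (map \<phi> (rev us)) \<one>\<^bsub>G\<^esub>"

definition stabilizing_family :: "('a, 'm) rack_scheme \<Rightarrow> 'a list \<Rightarrow> bool" where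
  "stabilizing_family X us \<longleftrightarrow> set us \<subseteq> carrier X \<and>
     rev_prod (BijGroup (carrier X)) (left_trans X) us = \<one>\<^bsub>BijGroup (carrier X)\<^esub>"

definition strong_representation ::
    "('a, 'm) rack_scheme \<Rightarrow> ('k, 'p) ring_scheme \<Rightarrow> ('k, 'v, 'n) module_scheme
     \<Rightarrow> ('a \<Rightarrow> 'v \<Rightarrow> 'v) \<Rightarrow> bool" where
  "strong_representation X K V \<rho> \<longleftrightarrow> rack_representation X K V \<rho> \<and>
     (\<forall>us. stabilizing_family X us \<longrightarrow> rev_prod (GL K V) \<rho> us = \<one>\<^bsub>GL K V\<^esub>)"

end

theory Submission
  imports Defs
begin

text \<open>
  The associated group acts on \<open>X\<close> by permutations, \<open>g\<^sub>x\<close> acting as \<open>L\<^sub>x\<close>, and the defining relations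
  say that conjugation realizes this action on the generators: if \<open>w = g\<^bsub>u\<^sub>k\<^esub> \<dots> g\<^bsub>u\<^sub>1\<^esub>\<close>, then
  \<open>w g\<^sub>y w\<^sup>-\<^sup>1 = g\<^sub>z\<close> with \<open>z = L\<^bsub>u\<^sub>k\<^esub> \<dots> L\<^bsub>u\<^sub>1\<^esub> y\<close> (lemma \<open>rev_prod_As_gen_conj\<close>). For a
  stabilizing family, \<open>w\<close> therefore commutes with every generator, that is, \<open>w\<close> is central in \<open>As(X)\<close>
  (lemma \<open>stabilizing_family_central\<close>).

  This is used twice. The constant family \<open>x\<^sub>0, \<dots>, x\<^sub>0\<close> of length \<open>n\<close> is stabilizing, so \<open>g\<^bsub>x\<^sub>0\<^esub>\<^sup>n\<close> is
  central, and the finite enveloping group is a quotient by a normal subgroup. And for an arbitrary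
  stabilizing family the image of \<open>w\<close> is central in that quotient, hence trivial when the centre
  is; every homomorphism out of the quotient then sends it to the identity.
\<close>

section \<open>Products along lists and centralizers\<close>

lemma rev_prod_Nil [simp]: "rev_prod G \<phi> [] = \<one>\<^bsub>G\<^esub>"
  by (simp add: rev_prod_def)

lemma rev_prod_snoc [simp]: "rev_prod G \<phi> (us @ [u]) = \<phi> u \<otimes>\<^bsub>G\<^esub> rev_prod G \<phi> us"
  by (simp add: rev_prod_def)

lemma (in monoid) rev_prod_closed:
  "(\<And>u. u \<in> set us \<Longrightarrow> \<phi> u \<in> carrier G) \<Longrightarrow> rev_prod G \<phi> us \<in> carrier G"
  by (induction us rule: rev_induct) auto

lemma (in monoid) rev_prod_replicate:
  assumes "\<phi> u \<in> carrier G"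
  shows "rev_prod G \<phi> (replicate k u) = \<phi> u [^] k"
proof (induction k)
  case (Suc k)
  have "replicate (Suc k) u = replicate k u @ [u]"
    by (simp add: replicate_append_same)
  then show ?case
    using Suc assms nat_pow_comm[of "\<phi> u" 1 k] by (simp del: replicate_Suc)
qed simp

lemma (in group_hom) hom_rev_prod:
  assumes "\<And>u. u \<in> set us \<Longrightarrow> \<phi> u \<in> carrier G"
  shows "h (rev_prod G \<phi> us) = rev_prod H (\<lambda>u. h (\<phi> u)) us"
  using assms
  by (induction us rule: rev_induct) (auto simp: G.rev_prod_closed)

lemma (in group) commutes_with_generate:
  assumes z: "z \<in> carrier G" and S: "S \<subseteq> carrier G"
    and comm: "\<And>s. s \<in> S \<Longrightarrow> z \<otimes> s = s \<otimes> z"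
    and g: "g \<in> generate G S"
  shows "z \<otimes> g = g \<otimes> z"
  using g
proof induction
  case (inv s)
  with S have s: "s \<in> carrier G" by blast
  have "z \<otimes> inv s = inv s \<otimes> (s \<otimes> z) \<otimes> inv s"
    using z s by (simp add: m_assoc[symmetric])
  also have "\<dots> = inv s \<otimes> z"
    using z s by (simp add: comm[OF inv, symmetric] m_assoc)
  finally show ?case .
next
  case (eng a b)
  then have ab: "a \<in> carrier G" "b \<in> carrier G"
    using generate_in_carrier[OF S] by auto
  have "z \<otimes> (a \<otimes> b) = a \<otimes> z \<otimes> b"
    using ab z eng.IH(1) by (simp add: m_assoc[symmetric])
  also have "\<dots> = a \<otimes> b \<otimes> z"
    using ab z eng.IH(2) by (simp add: m_assoc)
  finally show ?case .
qed (use z comm in auto)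

lemma (in group) generate_center_normal:
  assumes z: "z \<in> group_center G"
  shows "generate G {z} \<lhd> G"
proof -
  have zc: "z \<in> carrier G" using z by (simp add: group_center_def)
  have comm: "g \<otimes> h = h \<otimes> g" if "g \<in> carrier G" "h \<in> generate G {z}" for g h
    using that z zc
    by (intro commutes_with_generate[of g "{z}" h]) (auto simp: group_center_def)
  have sub: "subgroup (generate G {z}) G"
    using zc by (intro generate_is_subgroup) simp
  have "g \<otimes> h \<otimes> inv g = h" if g: "g \<in> carrier G" and h: "h \<in> generate G {z}" for g h
    using g subgroup.mem_carrier[OF sub h] by (simp add: comm[OF g h] m_assoc)
  then show ?thesis
    using sub by (simp add: normal_inv_iff)
qed

section \<open>Generators of a presented group\<close>

lemma carrier_pres_group: "carrier (pres_group S R) = (\<lambda>w. pres_cong S R `` {w}) ` words S"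
  by (auto simp: pres_group_def quotient_def)

lemma letter_in_words: "s \<in> S \<Longrightarrow> [(b, s)] \<in> words S"
  by (simp add: words_def)

lemma pres_gen_closed: "s \<in> S \<Longrightarrow> pres_gen S R s \<in> carrier (pres_group S R)"
  by (simp add: carrier_pres_group pres_gen_def letter_in_words)

lemma inv_pres_gen:
  assumes R: "R \<subseteq> words S \<times> words S" and s: "s \<in> S"
  shows "inv\<^bsub>pres_group S R\<^esub> pres_gen S R s = pres_cong S R `` {[(False, s)]}"
proof -
  interpret group "pres_group S R" by (rule group_pres_group[OF R])
  have "pres_cong S R `` {[(False, s), (True, s)]} = pres_cong S R `` {[]}"
    using pres_cong.cancel[OF s, of False R]
    by (intro equiv_class_eq[OF equiv_pres_cong[OF R]]) simp
  then have "pres_cong S R `` {[(False, s)]} \<otimes>\<^bsub>pres_group S R\<^esub> pres_gen S R s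
      = \<one>\<^bsub>pres_group S R\<^esub>"
    using s by (simp add: pres_gen_def pres_mult_class[OF R] letter_in_words)
      (simp add: pres_group_def)
  then show ?thesis
    using s by (intro inv_equality pres_gen_closed)
      (auto simp: carrier_pres_group letter_in_words)
qed

lemma pres_group_generated:
  assumes R: "R \<subseteq> words S \<times> words S"
  shows "carrier (pres_group S R) = generate (pres_group S R) (pres_gen S R ` S)"
proof
  let ?G = "pres_group S R"
  interpret group ?G by (rule group_pres_group[OF R])
  show "generate ?G (pres_gen S R ` S) \<subseteq> carrier ?G"
    by (intro generate_incl) (auto simp: pres_gen_closed)
  have "pres_cong S R `` {w} \<in> generate ?G (pres_gen S R ` S)" if "w \<in> words S" for w
    using that
  proof (induction w)
    case Nil
    then show ?case
      using generate.one[of ?G] by (simp add: pres_group_def)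
  next
    case (Cons l w)
    obtain b s where l: "l = (b, s)" by force
    from Cons.prems have s: "s \<in> S" and w: "w \<in> words S" by (auto simp: words_def l)
    have "pres_cong S R `` {[l]} \<in> generate ?G (pres_gen S R ` S)"
    proof (cases b)
      case True
      then show ?thesis
        using s by (auto simp: l pres_gen_def intro!: generate.incl)
    next
      case False
      then show ?thesis
        using generate.inv[of "pres_gen S R s" "pres_gen S R ` S" ?G] s
        by (simp add: l inv_pres_gen[OF R s])
    qed
    moreover have "pres_cong S R `` {l # w} = pres_cong S R `` {[l]} \<otimes>\<^bsub>?G\<^esub> pres_cong S R `` {w}"
      using pres_mult_class[OF R letter_in_words[OF s] w] by (simp add: l)
    ultimately show ?case
      using Cons.IH[OF w] by (simp add: generate.eng)
  qed
  then show "carrier ?G \<subseteq> generate ?G (pres_gen S R ` S)"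
    by (auto simp: carrier_pres_group)
qed

section \<open>Stabilizing families are central in the associated group\<close>

context rack
begin

lemma As_rels_words: "As_rels X \<subseteq> words (carrier X) \<times> words (carrier X)"
  by (auto simp: As_rels_def words_def op_closed)

lemma As_gen_closed: "x \<in> carrier X \<Longrightarrow> As_gen X x \<in> carrier (As X)"
  by (simp add: As_gen_def As_def pres_gen_closed)

lemma As_gen_op:
  assumes x: "x \<in> carrier X" and y: "y \<in> carrier X"
  shows "As_gen X (x \<triangleright> y) = As_gen X x \<otimes>\<^bsub>As X\<^esub> As_gen X y \<otimes>\<^bsub>As X\<^esub> inv\<^bsub>As X\<^esub> As_gen X x"
proof -
  let ?S = "carrier X" and ?R = "As_rels X"
  note R = As_rels_words and m = pres_mult_class[OF As_rels_words]
  have "As_gen X (x \<triangleright> y) = pres_cong ?S ?R `` {[(True, x), (True, y), (False, x)]}"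
    unfolding As_gen_def pres_gen_def
    using x y by (intro equiv_class_eq[OF equiv_pres_cong[OF R]] pres_cong.rel)
      (auto simp: As_rels_def)
  also have "\<dots> = pres_gen ?S ?R x \<otimes>\<^bsub>As X\<^esub> pres_gen ?S ?R y \<otimes>\<^bsub>As X\<^esub> pres_cong ?S ?R `` {[(False, x)]}"
    using x y by (simp add: As_def pres_gen_def m words_def)
  finally show ?thesis
    using inv_pres_gen[OF R x] by (simp add: As_gen_def As_def)
qed

lemma BijGroup_mult_apply:
  "\<lbrakk>f \<in> carrier (BijGroup S); g \<in> carrier (BijGroup S); y \<in> S\<rbrakk>
    \<Longrightarrow> (f \<otimes>\<^bsub>BijGroup S\<^esub> g) y = f (g y)"
  by (simp add: BijGroup_def compose_eq)

lemma left_trans_Bij: "x \<in> carrier X \<Longrightarrow> left_trans X x \<in> carrier (BijGroup (carrier X))"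
  using left_bij[of x]
  by (simp add: left_trans_def BijGroup_def Bij_def bij_betw_restrict_eq)

text \<open>Each further letter conjugates once more, and the relation \<open>As_gen_op\<close> turns this conjugation
  into one more left translation of the index.\<close>

lemma rev_prod_As_gen_conj:
  assumes "set us \<subseteq> carrier X" and "y \<in> carrier X"
  shows "rev_prod (BijGroup (carrier X)) (left_trans X) us y \<in> carrier X \<and>
    rev_prod (As X) (As_gen X) us \<otimes>\<^bsub>As X\<^esub> As_gen X y
    = As_gen X (rev_prod (BijGroup (carrier X)) (left_trans X) us y)
      \<otimes>\<^bsub>As X\<^esub> rev_prod (As X) (As_gen X) us"
  using assms(1)
proof (induction us rule: rev_induct)
  case Nil
  interpret group "As X" by (rule group_As)
  show ?case
    using assms(2) by (simp add: BijGroup_def As_gen_closed)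
next
  case (snoc u us)
  interpret group "As X" by (rule group_As)
  interpret B: group "BijGroup (carrier X)" by (rule group_BijGroup)
  let ?w = "rev_prod (As X) (As_gen X) us" and ?g = "As_gen X"
  let ?f = "rev_prod (BijGroup (carrier X)) (left_trans X) us"
  from snoc.prems have u: "u \<in> carrier X" and us: "set us \<subseteq> carrier X" by auto
  from snoc.IH[OF us] have fy: "?f y \<in> carrier X"
    and IH: "?w \<otimes>\<^bsub>As X\<^esub> ?g y = ?g (?f y) \<otimes>\<^bsub>As X\<^esub> ?w" by auto
  have "?f \<in> carrier (BijGroup (carrier X))"
    using us by (intro B.rev_prod_closed left_trans_Bij) auto
  then have L: "rev_prod (BijGroup (carrier X)) (left_trans X) (us @ [u]) y = u \<triangleright> ?f y"
    using BijGroup_mult_apply[OF left_trans_Bij[OF u] _ assms(2)] fy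
    by (simp add: left_trans_def)
  have c: "?w \<in> carrier (As X)" "?g u \<in> carrier (As X)" "?g y \<in> carrier (As X)"
    "?g (?f y) \<in> carrier (As X)"
    using us u fy assms(2) by (auto intro!: rev_prod_closed simp: As_gen_closed)
  have "(?g u \<otimes>\<^bsub>As X\<^esub> ?w) \<otimes>\<^bsub>As X\<^esub> ?g y = ?g u \<otimes>\<^bsub>As X\<^esub> (?g (?f y) \<otimes>\<^bsub>As X\<^esub> ?w)"
    using c by (simp add: m_assoc IH)
  also have "\<dots> = ?g u \<otimes>\<^bsub>As X\<^esub> ?g (?f y) \<otimes>\<^bsub>As X\<^esub> (inv\<^bsub>As X\<^esub> ?g u \<otimes>\<^bsub>As X\<^esub> ?g u) \<otimes>\<^bsub>As X\<^esub> ?w"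
    using c by (simp add: m_assoc)
  also have "\<dots> = ?g (u \<triangleright> ?f y) \<otimes>\<^bsub>As X\<^esub> (?g u \<otimes>\<^bsub>As X\<^esub> ?w)"
    using c by (simp only: As_gen_op[OF u fy] m_assoc m_closed inv_closed)
  finally show ?case
    using op_closed[OF u fy] by (simp add: L del: rev_prod_snoc) simp
qed

lemma stabilizing_family_central:
  assumes st: "stabilizing_family X us"
  shows "rev_prod (As X) (As_gen X) us \<in> group_center (As X)"
proof -
  interpret group "As X" by (rule group_As)
  let ?w = "rev_prod (As X) (As_gen X) us"
  from st have us: "set us \<subseteq> carrier X"
    and id: "rev_prod (BijGroup (carrier X)) (left_trans X) us = \<one>\<^bsub>BijGroup (carrier X)\<^esub>"
    by (auto simp: stabilizing_family_def)
  have w: "?w \<in> carrier (As X)"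
    using us by (intro rev_prod_closed As_gen_closed) auto
  have "?w \<otimes>\<^bsub>As X\<^esub> As_gen X y = As_gen X y \<otimes>\<^bsub>As X\<^esub> ?w" if "y \<in> carrier X" for y
    using rev_prod_As_gen_conj[OF us that] that by (simp add: id) (simp add: BijGroup_def)
  then have comm: "?w \<otimes>\<^bsub>As X\<^esub> s = s \<otimes>\<^bsub>As X\<^esub> ?w" if "s \<in> As_gen X ` carrier X" for s
    using that by blast
  have "?w \<otimes>\<^bsub>As X\<^esub> g = g \<otimes>\<^bsub>As X\<^esub> ?w"
    if "g \<in> generate (As X) (As_gen X ` carrier X)" for g
    using As_gen_closed by (intro commutes_with_generate[OF w _ comm that]) auto
  moreover have "carrier (As X) = generate (As X) (As_gen X ` carrier X)"
    using pres_group_generated[OF As_rels_words] by (simp add: As_def As_gen_def[abs_def])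
  ultimately show ?thesis
    using w by (simp add: group_center_def)
qed

section \<open>The finite enveloping group and its representations\<close>

text \<open>Since \<open>L\<^sub>x\<close> has order \<open>n\<close>, the family \<open>x, \<dots>, x\<close> of length \<open>n\<close> is stabilizing, so \<open>g\<^sub>x\<^sup>n\<close> is
  central.\<close>

lemma env_subgroup_normal:
  assumes x: "x \<in> carrier X"
  shows "env_subgroup X x \<lhd> As X"
proof -
  interpret group "As X" by (rule group_As)
  interpret B: group "BijGroup (carrier X)" by (rule group_BijGroup)
  let ?n = "B.ord (left_trans X x)"
  have "stabilizing_family X (replicate ?n x)"
    using x by (auto simp: stabilizing_family_def B.rev_prod_replicate left_trans_Bij
        B.pow_ord_eq_1[OF left_trans_Bij[OF x]])
  then have "As_gen X x [^]\<^bsub>As X\<^esub> ?n \<in> group_center (As X)"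
    using stabilizing_family_central rev_prod_replicate[of "As_gen X" x ?n] As_gen_closed[OF x]
    by metis
  then show ?thesis
    unfolding env_subgroup_def by (rule generate_center_normal)
qed

lemma As_hom_rack_hom:
  assumes H: "group H" and h: "h \<in> hom (As X) H"
  shows "(\<lambda>x. h (As_gen X x)) \<in> rack_hom X (Conj H)"
proof -
  interpret group_hom "As X" H h
    by (rule group_hom.intro[OF group_As H]) (rule group_hom_axioms.intro[OF h])
  show ?thesis
    by (auto simp: rack_hom_def Conj_def As_gen_op As_gen_closed)
qed

lemma stabilizing_family_fin_env_trivial:
  assumes x: "x \<in> carrier X" and st: "stabilizing_family X us"
    and Z: "group_center (fin_env_group X x) = {\<one>\<^bsub>fin_env_group X x\<^esub>}"
  shows "env_subgroup X x #>\<^bsub>As X\<^esub> rev_prod (As X) (As_gen X) us = \<one>\<^bsub>fin_env_group X x\<^esub>"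
proof -
  interpret normal "env_subgroup X x" "As X" by (rule env_subgroup_normal[OF x])
  let ?w = "rev_prod (As X) (As_gen X) us"
  have w: "?w \<in> carrier (As X)"
    and comm: "\<And>g. g \<in> carrier (As X) \<Longrightarrow> ?w \<otimes>\<^bsub>As X\<^esub> g = g \<otimes>\<^bsub>As X\<^esub> ?w"
    using stabilizing_family_central[OF st] by (auto simp: group_center_def)
  have "env_subgroup X x #>\<^bsub>As X\<^esub> ?w \<in> group_center (fin_env_group X x)"
    using w by (auto simp: group_center_def fin_env_group_def FactGroup_def RCOSETS_def
        rcos_sum comm)
  with Z show ?thesis by simp
qed

end

theorem theorem6p5:
  fixes X :: "('a, 'm) rack_scheme"
    and K :: "('k, 'p) ring_scheme"
    and V :: "('k, 'v, 'n) module_scheme"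
    and x\<^sub>0 :: 'a
    and \<rho>bar :: "'a word set set \<Rightarrow> 'v \<Rightarrow> 'v"
  assumes "connected_rack X" and "finite (carrier X)"
    and "x\<^sub>0 \<in> carrier X"
    and "field K" and "module K V"
    and "\<rho>bar \<in> hom (fin_env_group X x\<^sub>0) (GL K V)"
    and "group_center (fin_env_group X x\<^sub>0) = {\<one>\<^bsub>fin_env_group X x\<^sub>0\<^esub>}"
  shows "strong_representation X K V (\<lambda>x. \<rho>bar (fin_env_gen X x\<^sub>0 x))"
proof -
  interpret rack X using assms(1) by (rule connected_rack.axioms(1))
  let ?N = "env_subgroup X x\<^sub>0" and ?Q = "fin_env_group X x\<^sub>0"
  interpret N: normal ?N "As X" by (rule env_subgroup_normal[OF assms(3)])
  interpret \<rho>: group_hom ?Q "GL K V" \<rho>bar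
    using N.factorgroup_is_group group_GL[OF assms(5)] assms(6)
    by (auto simp: fin_env_group_def group_hom_def group_hom_axioms_def)
  \<comment> \<open>Pulling the representation back to \<open>As X\<close> allows products of generators to be computed there,
    where the conjugation argument takes place.\<close>
  define h where "h = (\<lambda>g. \<rho>bar (?N #>\<^bsub>As X\<^esub> g))"
  have h: "h \<in> hom (As X) (GL K V)"
    using hom_compose[OF N.r_coset_hom_Mod, of \<rho>bar "GL K V"] assms(6)
    by (simp add: fin_env_group_def h_def comp_def)
  interpret h: group_hom "As X" "GL K V" h
    using h by unfold_locales
  have gen: "(\<lambda>x. \<rho>bar (fin_env_gen X x\<^sub>0 x)) = (\<lambda>x. h (As_gen X x))"
    by (simp add: h_def fin_env_gen_def)
  have "rev_prod (GL K V) (\<lambda>x. h (As_gen X x)) us = \<one>\<^bsub>GL K V\<^esub>"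
    if st: "stabilizing_family X us" for us
  proof -
    have "rev_prod (GL K V) (\<lambda>x. h (As_gen X x)) us = h (rev_prod (As X) (As_gen X) us)"
      using st by (subst h.hom_rev_prod) (auto simp: stabilizing_family_def As_gen_closed)
    also have "\<dots> = \<one>\<^bsub>GL K V\<^esub>"
      using stabilizing_family_fin_env_trivial[OF assms(3) st assms(7)] by (simp add: h_def)
    finally show ?thesis .
  qed
  then show ?thesis
    using As_hom_rack_hom[OF group_GL[OF assms(5)] h]
    by (simp add: strong_representation_def rack_representation_def gen)
qed

end
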